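(* Let $j\in\mathbb N$, $\gamma\in\mathbb R$, $T>0$, and let $u$ be a sufficiently smooth solution, decaying at infinity together with its spatial derivatives, of $$\partial_tu+(-1)^{j+1}\partial_x^{2j+1}u=f\ (0<t<T,\ x>0),\quad u(0,x)=u_0(x),\quad (\partial_x+\gamma)\partial_x^{\ell-1}u(t,0)=\varphi_\ell(t)\ (1\le\ell\le j),$$ with $u_0$, $\varphi_\ell$, $f$ sufficiently smooth and decaying. Let $1\le p\le j$ and $k\in D_{2p}^+$ with $k\ne i\gamma$. Then, for $0\le t\le T$, the vector $X(t,k)=(X_1,\dots,X_{j+1})$ with entries $$X_{m+1}(t,k)=(ik)^m\widetilde g_{2j-m}(t,k^{2j+1})\ (0\le m\le j-1),\qquad X_{j+1}(t,k)=(ik)^j\widetilde g_0(t,k^{2j+1})$$ satisfies $$\sum_{m=0}^{j-1}X_{m+1}(t,k)+\mathfrak a_0(1,k)X_{j+1}(t,k)=\sum_{n=1}^{j+1}\left(L_{p,n}(1)-\frac{Q_p(1)}{Q_p'(\alpha_{p,n})}\frac{k}{k-i\gamma}\right)\mathcal I_{p,n}(t,k).$$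
   Context: $\omega=e^{2\pi i/(2j+1)}$; for $1\le p\le j$, $1\le n\le j+1$: $\alpha_{p,n}=\omega^{j-p+n}$, $Q_p(z)=\prod_{m=1}^{j+1}(z-\alpha_{p,m})$, $L_{p,n}(z)=\prod_{1\le m\le j+1,\,m\ne n}\frac{z-\alpha_{p,m}}{\alpha_{p,n}-\alpha_{p,m}}$. $D_{2p}^+=\{re^{i\theta}:r>0,\ \frac{(2p-1)\pi}{2j+1}<\theta<\frac{2p\pi}{2j+1}\}$ (so $\operatorname{Im}(\alpha_{p,n}k)<0$ for $k\in D_{2p}^+$). For $\ell\ge0$, $\widetilde g_\ell(t,\lambda)=\int_0^te^{-i\lambda\tau}\partial_x^\ell u(\tau,0)\,d\tau$. For $\operatorname{Im}k\le 0$: $\widehat u(t,k)=\int_0^\infty e^{-ikx}u(t,x)\,dx$, and likewise $\widehat{u_0}(k)$, $\widehat f(t,k)$; $F(t,k)=\int_0^te^{-ik^{2j+1}\tau}\widehat f(\tau,k)\,d\tau$; $\widetilde\varphi_\ell(t,\zeta)=\int_0^te^{-i\zeta\tau}\varphi_\ell(\tau)\,d\tau$. For $0\le\ell\le j$, $\mathfrak b_\ell(k)=\sum_{q=\ell}^j(ik)^{2j-q}(-\gamma)^{q-\ell}$ (with $0^0=1$). For $z\in\mathbb C$, $k\ne0$, $\mathfrak a_0(z,k)=\mathfrak b_0(zk)/(ik)^j=\sum_{q=0}^ji^{j-q}k^{j-q}(-\gamma)^qz^{2j-q}$. For $1\le n\le j+1$, $$\mathcal I_{p,n}(t,k)=(-1)^j\left(-e^{-ik^{2j+1}t}\widehat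 u(t,\alpha_{p,n}k)+\widehat{u_0}(\alpha_{p,n}k)+F(t,\alpha_{p,n}k)\right)-\sum_{\ell=1}^j\mathfrak b_\ell(\alpha_{p,n}k)\widetilde\varphi_\ell(t,k^{2j+1}).$$ *)

theory Defs
  imports "HOL-Analysis.Analysis"
begin

text \<open>Functions on \<open>[0,T] \<times> [0,\<infinity>)\<close> are represented by total functions
  \<open>u :: real \<Rightarrow> real \<Rightarrow> complex\<close> (first argument time, second argument space); values outside this
  set are never used.  Derivatives are therefore taken within \<open>[0,\<infinity>)\<close>, resp. within \<open>[0,T]\<close>,
  which makes them one-sided at the boundary points.\<close>

definition dx :: "(real \<Rightarrow> complex) \<Rightarrow> real \<Rightarrow> complex" where
  "dx v x = vector_derivative v (at x within {0..})"

definition dt :: "real \<Rightarrow> (real \<Rightarrow> real \<Rightarrow> complex) \<Rightarrow> real \<Rightarrow> real \<Rightarrow> complex" where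
  "dt T u t x = vector_derivative (\<lambda>s. u s x) (at t within {0..T})"

text \<open>``Sufficiently smooth and decaying with its spatial derivatives'': the derivatives occurring
  in the equation, and all lower spatial ones, exist and are jointly continuous up to the boundary,
  and the spatial ones vanish as \<open>x \<rightarrow> \<infinity>\<close>, uniformly in \<open>t\<close>.  No rate of decay is required: the
  Fourier transforms below are only needed for \<open>Im k < 0\<close>.\<close>

definition smooth_decaying :: "nat \<Rightarrow> real \<Rightarrow> (real \<Rightarrow> real \<Rightarrow> complex) \<Rightarrow> bool" where
  "smooth_decaying j T u \<longleftrightarrow>
     (\<forall>t\<in>{0..T}. \<forall>x\<ge>0. (\<lambda>s. u s x) differentiable (at t within {0..T})) \<and>
     continuous_on ({0..T} \<times> {0..}) (\<lambda>(t, x). dt T u t x) \<and>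
     (\<forall>l\<le>2*j. \<forall>t\<in>{0..T}. \<forall>x\<ge>0. (dx ^^ l) (u t) differentiable (at x within {0..})) \<and>
     (\<forall>l\<le>2*j+1. continuous_on ({0..T} \<times> {0..}) (\<lambda>(t, x). (dx ^^ l) (u t) x)) \<and>
     (\<forall>l\<le>2*j+1. uniform_limit {0..T} (\<lambda>x t. (dx ^^ l) (u t) x) (\<lambda>_. 0) at_top)"

definition admissible_data ::
  "nat \<Rightarrow> real \<Rightarrow> (real \<Rightarrow> real \<Rightarrow> complex) \<Rightarrow> (real \<Rightarrow> complex) \<Rightarrow> (nat \<Rightarrow> real \<Rightarrow> complex) \<Rightarrow> bool" where
  "admissible_data j T f u0 \<phi> \<longleftrightarrow>
     continuous_on ({0..T} \<times> {0..}) (\<lambda>(t, x). f t x) \<and>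
     uniform_limit {0..T} (\<lambda>x t. f t x) (\<lambda>_. 0) at_top \<and>
     continuous_on {0..} u0 \<and> (u0 \<longlongrightarrow> 0) at_top \<and>
     (\<forall>l\<in>{1..j}. continuous_on {0..T} (\<phi> l))"

definition solves_ibvp ::
  "nat \<Rightarrow> real \<Rightarrow> real \<Rightarrow> (real \<Rightarrow> real \<Rightarrow> complex) \<Rightarrow> (real \<Rightarrow> complex) \<Rightarrow> (nat \<Rightarrow> real \<Rightarrow> complex)
    \<Rightarrow> (real \<Rightarrow> real \<Rightarrow> complex) \<Rightarrow> bool" where
  "solves_ibvp j \<gamma> T f u0 \<phi> u \<longleftrightarrow>
     (\<forall>t x. 0 < t \<and> t < T \<and> 0 < x \<longrightarrow>
        dt T u t x + (-1)^(j+1) * (dx ^^ (2*j+1)) (u t) x = f t x) \<and>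
     (\<forall>x>0. u 0 x = u0 x) \<and>
     (\<forall>l\<in>{1..j}. \<forall>t. 0 < t \<and> t < T \<longrightarrow>
        dx ((dx ^^ (l-1)) (u t)) 0 + of_real \<gamma> * (dx ^^ (l-1)) (u t) 0 = \<phi> l t)"

definition \<omega> :: "nat \<Rightarrow> complex" where
  "\<omega> j = exp (2 * of_real pi * \<i> / of_nat (2*j+1))"

text \<open>The subtraction \<open>j - p\<close> is on natural numbers; only \<open>p \<le> j\<close> is relevant.\<close>

definition \<alpha> :: "nat \<Rightarrow> nat \<Rightarrow> nat \<Rightarrow> complex" where
  "\<alpha> j p n = \<omega> j ^ (j - p + n)"

definition Q :: "nat \<Rightarrow> nat \<Rightarrow> complex poly" where
  "Q j p = (\<Prod>m=1..j+1. [:- \<alpha> j p m, 1:])"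

definition L :: "nat \<Rightarrow> nat \<Rightarrow> nat \<Rightarrow> complex \<Rightarrow> complex" where
  "L j p n z = (\<Prod>m\<in>{1..j+1} - {n}. (z - \<alpha> j p m) / (\<alpha> j p n - \<alpha> j p m))"

text \<open>The sector \<open>D\<^sub>2\<^sub>p\<^sup>+\<close>; note that the index is \<open>p\<close>, not \<open>2p\<close>.\<close>

definition D_plus :: "nat \<Rightarrow> nat \<Rightarrow> complex set" where
  "D_plus j p = {of_real r * exp (\<i> * of_real \<theta>) | r \<theta>. r > 0 \<and>
     (2 * real p - 1) * pi / real (2*j+1) < \<theta> \<and> \<theta> < 2 * real p * pi / real (2*j+1)}"

definition half_fourier :: "(real \<Rightarrow> complex) \<Rightarrow> complex \<Rightarrow> complex" where
  "half_fourier v k = (LBINT x:{0..}. exp (- \<i> * k * of_real x) * v x)"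

text \<open>The common shape of \<open>g\<^sub>\<ell>\<close>, \<open>\<phi>\<^sub>\<ell>\<close> (both with tilde) and \<open>F\<close>.\<close>

definition time_transform :: "(real \<Rightarrow> complex) \<Rightarrow> real \<Rightarrow> complex \<Rightarrow> complex" where
  "time_transform h t \<zeta> = (LBINT \<tau>:{0..t}. exp (- \<i> * \<zeta> * of_real \<tau>) * h \<tau>)"

definition g_tilde :: "(real \<Rightarrow> real \<Rightarrow> complex) \<Rightarrow> nat \<Rightarrow> real \<Rightarrow> complex \<Rightarrow> complex" where
  "g_tilde u l t \<zeta> = time_transform (\<lambda>\<tau>. (dx ^^ l) (u \<tau>) 0) t \<zeta>"

definition F :: "nat \<Rightarrow> (real \<Rightarrow> real \<Rightarrow> complex) \<Rightarrow> real \<Rightarrow> complex \<Rightarrow> complex" where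
  "F j f t k = time_transform (\<lambda>\<tau>. half_fourier (f \<tau>) k) t (k ^ (2*j+1))"

definition \<bb> :: "nat \<Rightarrow> real \<Rightarrow> nat \<Rightarrow> complex \<Rightarrow> complex" where
  "\<bb> j \<gamma> l k = (\<Sum>q=l..j. (\<i> * k) ^ (2*j - q) * (- of_real \<gamma>) ^ (q - l))"

definition \<aa>\<^sub>0 :: "nat \<Rightarrow> real \<Rightarrow> complex \<Rightarrow> complex \<Rightarrow> complex" where
  "\<aa>\<^sub>0 j \<gamma> z k = \<bb> j \<gamma> 0 (z * k) / (\<i> * k) ^ j"

definition \<I> ::
  "nat \<Rightarrow> real \<Rightarrow> (real \<Rightarrow> real \<Rightarrow> complex) \<Rightarrow> (real \<Rightarrow> complex) \<Rightarrow> (nat \<Rightarrow> real \<Rightarrow> complex)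
    \<Rightarrow> (real \<Rightarrow> real \<Rightarrow> complex) \<Rightarrow> nat \<Rightarrow> nat \<Rightarrow> real \<Rightarrow> complex \<Rightarrow> complex" where
  "\<I> j \<gamma> f u0 \<phi> u p n t k =
     (-1)^j * (- exp (- \<i> * k ^ (2*j+1) * of_real t) * half_fourier (u t) (\<alpha> j p n * k)
               + half_fourier u0 (\<alpha> j p n * k) + F j f t (\<alpha> j p n * k))
     - (\<Sum>l=1..j. \<bb> j \<gamma> l (\<alpha> j p n * k) * time_transform (\<phi> l) t (k ^ (2*j+1)))"

text \<open>The components \<open>1, \<dots>, j+1\<close> of the vector of unknown boundary values.\<close>

definition X :: "nat \<Rightarrow> (real \<Rightarrow> real \<Rightarrow> complex) \<Rightarrow> real \<Rightarrow> complex \<Rightarrow> nat \<Rightarrow> complex" where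
  "X j u t k n =
     (if n = j+1 then (\<i> * k) ^ j * g_tilde u 0 t (k ^ (2*j+1))
      else (\<i> * k) ^ (n-1) * g_tilde u (2*j - (n-1)) t (k ^ (2*j+1)))"

end

theory Submission imports Defs begin

text \<open>
  Throughout, write \<open>N = 2j + 1\<close>, \<open>\<zeta> = k^N\<close> and \<open>c = i \<gamma>\<close>.

  \<^bold>\<open>The global relation.\<close>  Let \<open>Im \<kappa> < 0\<close>.  Multiplying the equation by \<open>exp (- i \<kappa> x)\<close> and
  integrating by parts \<open>N\<close> times over the half line turns it into an ordinary differential equation
  in time for \<open>half_fourier (u t) \<kappa>\<close>, whose inhomogeneity consists of the transform of \<open>f\<close> and of the
  boundary values \<open>\<partial>\<^sub>x^l u(t,0)\<close>, \<open>l < N\<close>.  Solving it with the integrating factor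
  \<open>exp (- i \<kappa>^N t)\<close> gives \<open>global_relation\<close>, which is linear in the transforms \<open>g_tilde u l t (\<kappa>^N)\<close>.

  \<^bold>\<open>Elimination.\<close>  The boundary conditions express the transforms with \<open>1 \<le> l \<le> j\<close> through the one
  with \<open>l = 0\<close> and the data.  The \<open>\<alpha> j p n\<close> are \<open>N\<close>-th roots of unity and, for \<open>k\<close> in the given
  sector, they rotate \<open>k\<close> into the lower half plane.  So \<open>\<kappa> = \<alpha> j p n * k\<close> is admissible, and since
  \<open>\<kappa>^N = \<zeta>\<close> does not depend on \<open>n\<close>, the \<open>j + 1\<close> resulting relations share the same unknowns
  (\<open>\<I>_eq_unknowns\<close>):
  \<open>\<I>_n = (\<Sum>m<j. \<alpha>_n^m * X_(m+1)) + \<bb>_0 (\<alpha>_n * k) * g_0\<close>.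

  \<^bold>\<open>The weights.\<close>  It remains to find the combination of these relations whose coefficients are
  those at \<open>\<alpha> = 1\<close>.  As \<open>Q(1) / Q'(\<alpha>_n) = L_n(1) * (1 - \<alpha>_n)\<close>, the weights of the theorem are
  \<open>w_n = L_n(1) * (\<alpha>_n * k - c) / (k - c)\<close>.  The weights \<open>L_n(1)\<close> reproduce the value at \<open>1\<close> of every
  polynomial of degree at most \<open>j\<close>.  Hence the \<open>w_n\<close> reproduce the value at \<open>1\<close> of every function \<open>P\<close>
  for which \<open>(z * k - c) * P(z)\<close> agrees, at the nodes and at \<open>1\<close>, with a polynomial of degree at
  most \<open>j\<close>.  This is clear for \<open>P(z) = z^m\<close> with \<open>m < j\<close>.  It also holds for \<open>P(z) = \<bb>_0 (z * k)\<close>, of degree \<open>2j\<close>: up to the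
  factor \<open>- i\<close>, the geometric sum makes \<open>(z * k - c) * \<bb>_0 (z * k)\<close> equal to
  \<open>(i k)^N * z^N - (- \<gamma>)^(j+1) * (i k)^j * z^j\<close>, and \<open>z^N = 1\<close> at the nodes and at \<open>1\<close>.
\<close>

section \<open>Interpolation at the rotated nodes\<close>

text \<open>The left-hand side is the Lagrange interpolant of the monomial, which has degree below the
  number of nodes and therefore is its own interpolant.\<close>
lemma sum_lagrange_basis_mult_power:
  fixes x :: "'b \<Rightarrow> 'a :: field"
  assumes "finite S" and inj: "inj_on x S" and "m < card S"
  shows "(\<Sum>n\<in>S. (\<Prod>i\<in>S - {n}. (z - x i) / (x n - x i)) * x n ^ m) = z ^ m"
proof -
  define \<Lambda> where "\<Lambda> n = smult (\<Prod>i\<in>S - {n}. inverse (x n - x i)) (\<Prod>i\<in>S - {n}. [:- x i, 1:])" for n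
  define P where "P = (\<Sum>n\<in>S. smult (x n ^ m) (\<Lambda> n))"
  have poly_\<Lambda>: "poly (\<Lambda> n) y = (\<Prod>i\<in>S - {n}. (y - x i) / (x n - x i))" for n y
    by (simp add: \<Lambda>_def poly_prod prod.distrib[symmetric] divide_inverse mult.commute)
  have at_node: "poly (\<Lambda> n) (x i) = (if n = i then 1 else 0)" if "n \<in> S" "i \<in> S" for n i
  proof (cases "n = i")
    case True
    then have "(x i - x i') / (x n - x i') = 1" if "i' \<in> S - {n}" for i'
      using that \<open>i \<in> S\<close> inj by (auto simp: inj_on_def)
    then show ?thesis using True unfolding poly_\<Lambda> by (simp add: prod.neutral)
  next
    case False
    then have "(\<Prod>i'\<in>S - {n}. (x i - x i') / (x n - x i')) = 0"
      using that \<open>finite S\<close> by (intro prod_zero bexI[of _ i]) auto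
    then show ?thesis using False by (simp add: poly_\<Lambda>)
  qed
  have "degree (\<Lambda> n) < card S" if "n \<in> S" for n
  proof -
    have "degree (\<Prod>i\<in>S - {n}. [:- x i, 1:]) \<le> (\<Sum>i\<in>S - {n}. degree [:- x i, 1:])"
      using degree_prod_sum_le[of "S - {n}" "\<lambda>i. [:- x i, 1:]"] \<open>finite S\<close> by (simp add: o_def)
    also have "\<dots> = card (S - {n})" by simp
    also have "\<dots> < card S" using that \<open>finite S\<close> by (simp add: card_Diff1_less del: card_Diff_insert)
    finally show ?thesis unfolding \<Lambda>_def by (rule le_less_trans[OF degree_smult_le])
  qed
  then have "degree P < card S"
    unfolding P_def using \<open>finite S\<close> \<open>m < card S\<close>
    by (intro degree_sum_less) (auto intro: le_less_trans[OF degree_smult_le])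
  moreover have "poly P y = poly (monom 1 m) y" if "y \<in> x ` S" for y
  proof -
    from that obtain i where i: "i \<in> S" "y = x i" by blast
    have "poly P y = (\<Sum>n\<in>S. if n = i then x n ^ m else 0)"
      unfolding P_def poly_sum by (intro sum.cong) (auto simp: i at_node)
    then show ?thesis using i \<open>finite S\<close> by (simp add: poly_monom)
  qed
  ultimately have "P = monom 1 m"
    using inj \<open>m < card S\<close>
    by (intro poly_eqI_degree[of "x ` S"]) (auto simp: card_image degree_monom_eq)
  then have "poly P z = z ^ m" by (simp add: poly_monom)
  then show ?thesis unfolding P_def poly_sum by (simp add: poly_\<Lambda> mult.commute)
qed

lemma \<omega>_power:
  "\<omega> j ^ n = exp (2 * of_real pi * \<i> * of_nat n / of_nat (2*j+1))"
  unfolding \<omega>_def exp_of_nat_mult[symmetric] by (simp add: field_simps)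

lemma \<omega>_power_order: "\<omega> j ^ (2*j+1) = 1"
  unfolding \<omega>_power by (subst complex_root_unity_eq_1) auto

lemma \<alpha>_power_order: "\<alpha> j p n ^ (2*j+1) = 1"
proof -
  have "\<alpha> j p n ^ (2*j+1) = (\<omega> j ^ (2*j+1)) ^ (j - p + n)"
    unfolding \<alpha>_def power_mult[symmetric] by (simp only: mult.commute)
  then show ?thesis by (simp only: \<omega>_power_order power_one)
qed

lemma inj_on_\<alpha>:
  assumes "p \<ge> 1" "p \<le> j"
  shows "inj_on (\<alpha> j p) {1..j+1}"
proof (rule inj_onI)
  fix m n assume mn: "m \<in> {1..j+1}" "n \<in> {1..j+1}" and eq: "\<alpha> j p m = \<alpha> j p n"
  have "(j - p + m) mod (2*j+1) = (j - p + n) mod (2*j+1)"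
    using eq complex_root_unity_eq[of "2*j+1" "j - p + m" "j - p + n"]
    unfolding \<alpha>_def \<omega>_power by simp
  moreover have "j - p + m < 2*j+1" "j - p + n < 2*j+1" using mn assms by auto
  ultimately show "m = n" by simp
qed

text \<open>The quotient \<open>Q(1) / (Q'(\<alpha>_n) * (1 - \<alpha>_n))\<close> is the usual form of \<open>L_n(1)\<close>, because
  \<open>Q'(\<alpha>_n)\<close> is the product of the differences \<open>\<alpha>_n - \<alpha>_m\<close>.\<close>
lemma Q_quotient_eq_L:
  assumes "n \<in> {1..j+1}" "p \<ge> 1" "p \<le> j"
  shows "poly (Q j p) 1 / poly (pderiv (Q j p)) (\<alpha> j p n) = L j p n 1 * (1 - \<alpha> j p n)"
proof -
  define R where "R = (\<Prod>m\<in>{1..j+1} - {n}. [:- \<alpha> j p m, 1:])"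
  have Q: "Q j p = [:- \<alpha> j p n, 1:] * R"
    unfolding Q_def R_def using assms(1) by (subst prod.remove[of _ n]) auto
  have "poly R (\<alpha> j p n) \<noteq> 0"
    unfolding R_def using inj_on_\<alpha>[OF assms(2,3)] assms(1)
    by (auto simp: poly_prod inj_on_def)
  moreover have "poly (pderiv (Q j p)) (\<alpha> j p n) = poly R (\<alpha> j p n)"
    unfolding Q pderiv_mult by (simp add: pderiv_pCons)
  moreover have "L j p n 1 = poly R 1 / poly R (\<alpha> j p n)"
    unfolding L_def R_def by (simp add: poly_prod prod_dividef)
  moreover have "poly (Q j p) 1 = (1 - \<alpha> j p n) * poly R 1"
    unfolding Q by (simp add: algebra_simps)
  ultimately show ?thesis by simp
qed

text \<open>For \<open>c = i \<gamma>\<close>, this product form of the weights contains the factor that turns \<open>\<bb>_0\<close> into a polynomial of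
  degree at most \<open>j\<close> on the roots of unity.\<close>
lemma weight_eq:
  assumes "n \<in> {1..j+1}" "p \<ge> 1" "p \<le> j" "k \<noteq> c"
  shows "L j p n 1 - poly (Q j p) 1 / poly (pderiv (Q j p)) (\<alpha> j p n) * (k / (k - c)) =
         L j p n 1 * ((\<alpha> j p n * k - c) / (k - c))"
  unfolding Q_quotient_eq_L[OF assms(1-3)] using assms(4) by (simp add: field_simps)

lemma sum_L_power:
  assumes "p \<ge> 1" "p \<le> j" "m \<le> j"
  shows "(\<Sum>n=1..j+1. L j p n z * \<alpha> j p n ^ m) = z ^ m"
  unfolding L_def using assms
  by (intro sum_lagrange_basis_mult_power inj_on_\<alpha>) auto

text \<open>A geometric sum, left in multiplied form: for negative \<open>\<gamma>\<close> the factor \<open>i \<kappa> + \<gamma>\<close> can vanish at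
  one of the points \<open>\<kappa> = \<alpha>_n * k\<close> at which the identity is used.\<close>
lemma \<bb>_0_closed_form:
  "(\<i> * \<kappa> + of_real \<gamma>) * \<bb> j \<gamma> 0 \<kappa> =
     (\<i> * \<kappa>) ^ (2*j+1) - (\<i> * \<kappa>) ^ j * (- of_real \<gamma>) ^ (j+1)"
proof -
  define a where "a = \<i> * \<kappa>"
  define b where "b = - complex_of_real \<gamma>"
  have "\<bb> j \<gamma> 0 \<kappa> = (\<Sum>q=0..j. a ^ j * (b ^ q * a ^ (j - q)))"
    unfolding \<bb>_def a_def[symmetric] b_def[symmetric]
    by (intro sum.cong) (auto simp: power_add[symmetric] simp flip: mult_2)
  also have "\<dots> = a ^ j * (\<Sum>q<Suc j. b ^ q * a ^ (j - q))"
    by (simp add: sum_distrib_left atLeast0AtMost lessThan_Suc_atMost)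
  finally have "(a - b) * \<bb> j \<gamma> 0 \<kappa> = a ^ j * ((a - b) * (\<Sum>q<Suc j. b ^ q * a ^ (j - q)))"
    by (simp only: mult_ac)
  also have "(a - b) * (\<Sum>q<Suc j. b ^ q * a ^ (j - q)) = a ^ Suc j - b ^ Suc j"
    using diff_power_eq_sum[of b j a] by (simp add: algebra_simps)
  finally have "(a - b) * \<bb> j \<gamma> 0 \<kappa> = a ^ (2*j+1) - a ^ j * b ^ (j+1)"
    by (simp add: right_diff_distrib power_add mult_2 mult_2_right mult_ac)
  then show ?thesis by (simp add: a_def b_def)
qed

lemma weighted_sum_power:
  assumes "p \<ge> 1" "p \<le> j" "k \<noteq> c" "m < j"
  shows "(\<Sum>n=1..j+1. L j p n 1 * ((\<alpha> j p n * k - c) / (k - c)) * \<alpha> j p n ^ m) = 1"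
proof -
  have "(\<Sum>n=1..j+1. L j p n 1 * ((\<alpha> j p n * k - c) / (k - c)) * \<alpha> j p n ^ m) =
     (\<Sum>n=1..j+1. (k / (k - c)) * (L j p n 1 * \<alpha> j p n ^ Suc m)
        - (c / (k - c)) * (L j p n 1 * \<alpha> j p n ^ m))"
    by (intro sum.cong refl) (simp add: field_simps diff_divide_distrib)
  also have "\<dots> = k / (k - c) - c / (k - c)"
    unfolding sum_subtractf sum_distrib_left[symmetric]
    using assms by (simp only: sum_L_power Suc_leI less_imp_le power_one mult_1_right)
  finally show ?thesis using assms by (simp add: field_simps diff_divide_distrib[symmetric])
qed

text \<open>The weight contributes exactly the factor of \<open>\<bb>_0_closed_form\<close>, up to \<open>- i\<close>.  On the roots of
  unity the top-degree term of the closed form is constant, so only the powers \<open>0\<close> and \<open>j\<close> of the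
  node remain, and both are interpolated exactly.\<close>
lemma weighted_sum_\<bb>_0:
  assumes "p \<ge> 1" "p \<le> j" "k \<noteq> \<i> * of_real \<gamma>"
  shows "(\<Sum>n=1..j+1. L j p n 1 * ((\<alpha> j p n * k - \<i> * of_real \<gamma>) / (k - \<i> * of_real \<gamma>))
           * \<bb> j \<gamma> 0 (\<alpha> j p n * k)) = \<bb> j \<gamma> 0 k"
proof -
  let ?c = "\<i> * of_real \<gamma>"
  define A where "A = - \<i> * (\<i> * k) ^ (2*j+1)"
  define B where "B = \<i> * (\<i> * k) ^ j * (- of_real \<gamma>) ^ (j+1)"
  have shift: "\<kappa> - ?c = - \<i> * (\<i> * \<kappa> + of_real \<gamma>)" for \<kappa>
    by (simp add: algebra_simps)
  have root: "(z * k - ?c) * \<bb> j \<gamma> 0 (z * k) = A + B * z ^ j" if "z ^ (2*j+1) = 1" for z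
    unfolding shift mult.assoc \<bb>_0_closed_form A_def B_def
    using that by (simp add: power_mult_distrib algebra_simps)
  have "(\<Sum>n=1..j+1. L j p n 1 * ((\<alpha> j p n * k - ?c) / (k - ?c)) * \<bb> j \<gamma> 0 (\<alpha> j p n * k)) =
        (\<Sum>n=1..j+1. L j p n 1 * ((\<alpha> j p n * k - ?c) * \<bb> j \<gamma> 0 (\<alpha> j p n * k))) / (k - ?c)"
    by (simp add: sum_divide_distrib mult.assoc del: sum.cl_ivl_Suc)
  also have "(\<Sum>n=1..j+1. L j p n 1 * ((\<alpha> j p n * k - ?c) * \<bb> j \<gamma> 0 (\<alpha> j p n * k))) =
        (\<Sum>n=1..j+1. A * (L j p n 1 * \<alpha> j p n ^ 0) + B * (L j p n 1 * \<alpha> j p n ^ j))"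
    by (intro sum.cong refl) (simp only: root[OF \<alpha>_power_order], simp add: algebra_simps)
  also have "\<dots> = A + B"
    unfolding sum.distrib sum_distrib_left[symmetric]
    using assms by (simp only: sum_L_power le0 le_refl power_one mult_1_right)
  also have "\<dots> = (k - ?c) * \<bb> j \<gamma> 0 k" using root[of 1] by simp
  finally show ?thesis using assms by simp
qed

text \<open>The argument of \<open>\<alpha>_n * k\<close> lies strictly between \<open>(2j + 2n - 1) \<pi> / N\<close> and
  \<open>(2j + 2n) \<pi> / N\<close>; for \<open>1 \<le> n \<le> j + 1\<close> this interval is contained in \<open>[\<pi>, 2\<pi>]\<close>.\<close>
lemma Im_\<alpha>_mult_less_0:
  assumes "n \<in> {1..j+1}" "p \<ge> 1" "p \<le> j" "k \<in> D_plus j p"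
  shows "Im (\<alpha> j p n * k) < 0"
proof -
  define N where "N = real (2*j+1)"
  have "N > 0" by (simp add: N_def)
  obtain r \<theta> where k: "k = of_real r * exp (\<i> * of_real \<theta>)" and "r > 0"
    and \<theta>: "(2 * real p - 1) * pi / N < \<theta>" "\<theta> < 2 * real p * pi / N"
    using assms(4) by (auto simp: D_plus_def N_def)
  define \<psi> where "\<psi> = 2 * pi * real (j - p + n) / N + \<theta>"
  have "\<alpha> j p n = exp (\<i> * of_real (2 * pi * real (j - p + n) / N))"
    unfolding \<alpha>_def \<omega>_power N_def by (simp add: mult_ac)
  then have "\<alpha> j p n * k = of_real r * exp (\<i> * of_real \<psi>)"
    unfolding k \<psi>_def by (simp add: distrib_left exp_add mult_ac)
  then have Im: "Im (\<alpha> j p n * k) = r * sin \<psi>"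
    by (simp add: Im_exp)
  have "pi = (2 * pi * real (j - p + 1) + (2 * real p - 1) * pi) / N"
    using assms \<open>N > 0\<close> by (simp add: N_def field_simps of_nat_diff)
  also have "\<dots> \<le> 2 * pi * real (j - p + n) / N + (2 * real p - 1) * pi / N"
    unfolding add_divide_distrib[symmetric] using assms(1) \<open>N > 0\<close>
    by (intro divide_right_mono add_right_mono mult_left_mono) auto
  also have "\<dots> < \<psi>" using \<theta> by (simp add: \<psi>_def)
  finally have "pi < \<psi>" .
  have "\<psi> < 2 * pi * real (j - p + n) / N + 2 * real p * pi / N" using \<theta> by (simp add: \<psi>_def)
  also have "\<dots> \<le> (2 * pi * real (2*j + 1 - p) + 2 * real p * pi) / N"
    unfolding add_divide_distrib[symmetric] using assms(1,3) \<open>N > 0\<close>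
    by (intro divide_right_mono add_right_mono mult_left_mono) auto
  also have "\<dots> = 2 * pi" using assms \<open>N > 0\<close> by (simp add: N_def field_simps of_nat_diff)
  finally have "\<psi> < 2 * pi" .
  with \<open>pi < \<psi>\<close> have "sin \<psi> < 0" by (intro sin_lt_zero)
  then show ?thesis using \<open>r > 0\<close> unfolding Im by (simp add: mult_pos_neg)
qed

section \<open>Fourier transforms on the half line\<close>

text \<open>On \<open>[0, R]\<close> all integrands are continuous up to the boundary, so that integrals may be
  exchanged freely; the decay is used only when \<open>R\<close> tends to infinity.\<close>
definition truncated_fourier :: "real \<Rightarrow> (real \<Rightarrow> complex) \<Rightarrow> complex \<Rightarrow> complex" where
  "truncated_fourier R v \<kappa> = integral {0..R} (\<lambda>x. exp (- \<i> * \<kappa> * of_real x) * v x)"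

text \<open>The boundary terms produced by integrating \<open>exp (- i \<kappa> x) * \<partial>\<^sub>x^N v\<close> by parts \<open>N\<close> times.\<close>
definition boundary_form :: "nat \<Rightarrow> complex \<Rightarrow> (real \<Rightarrow> complex) \<Rightarrow> real \<Rightarrow> complex" where
  "boundary_form N \<kappa> v x =
     exp (- \<i> * \<kappa> * of_real x) * (\<Sum>l<N. (\<i> * \<kappa>) ^ (N - Suc l) * (dx ^^ l) v x)"

lemma has_vector_derivative_dx_power:
  assumes "(dx ^^ l) v differentiable (at x within {0..})"
  shows "((dx ^^ l) v has_vector_derivative (dx ^^ Suc l) v x) (at x within {0..})"
  using assms by (simp add: vector_derivative_works dx_def)

lemma has_vector_derivative_exp_mult_of_real:
  "((\<lambda>x. exp (c * of_real x)) has_vector_derivative c * exp (c * of_real x)) (at x within S)"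
  for c :: complex
  by (rule has_vector_derivative_real_field) (auto intro!: derivative_eq_intros)

text \<open>The product rule makes the derivative a telescoping sum of the terms
  \<open>(i \<kappa>)^(N - l) * \<partial>\<^sub>x^l v\<close>, of which \<open>l = 0\<close> and \<open>l = N\<close> survive.\<close>
lemma has_vector_derivative_boundary_form:
  assumes "\<And>l. l < N \<Longrightarrow> (dx ^^ l) v differentiable (at x within {0..})"
  shows "(boundary_form N \<kappa> v has_vector_derivative
           exp (- \<i> * \<kappa> * of_real x) * ((dx ^^ N) v x - (\<i> * \<kappa>) ^ N * v x)) (at x within {0..})"
proof -
  define e where "e = exp (- \<i> * \<kappa> * of_real x)"
  define D where "D l = (\<i> * \<kappa>) ^ (N - l) * (dx ^^ l) v x" for l
  have exp: "((\<lambda>x. exp (- \<i> * \<kappa> * of_real x)) has_vector_derivative - \<i> * \<kappa> * e)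
      (at x within {0..})"
    unfolding e_def by (rule has_vector_derivative_exp_mult_of_real)
  have "(boundary_form N \<kappa> v has_vector_derivative
      e * (\<Sum>l<N. (\<i> * \<kappa>) ^ (N - Suc l) * (dx ^^ Suc l) v x) +
      - \<i> * \<kappa> * e * (\<Sum>l<N. (\<i> * \<kappa>) ^ (N - Suc l) * (dx ^^ l) v x)) (at x within {0..})"
    unfolding boundary_form_def e_def
    by (intro has_vector_derivative_mult exp[unfolded e_def] has_vector_derivative_sum
          has_vector_derivative_mult_right has_vector_derivative_dx_power assms) auto
  also have "e * (\<Sum>l<N. (\<i> * \<kappa>) ^ (N - Suc l) * (dx ^^ Suc l) v x) +
      - \<i> * \<kappa> * e * (\<Sum>l<N. (\<i> * \<kappa>) ^ (N - Suc l) * (dx ^^ l) v x) =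
      e * (\<Sum>l<N. (\<i> * \<kappa>) ^ (N - Suc l) * (dx ^^ Suc l) v x
              - (\<i> * \<kappa>) ^ Suc (N - Suc l) * (dx ^^ l) v x)"
    by (simp add: sum_subtractf sum_negf sum_distrib_left algebra_simps del: funpow.simps)
  also have "(\<Sum>l<N. (\<i> * \<kappa>) ^ (N - Suc l) * (dx ^^ Suc l) v x
              - (\<i> * \<kappa>) ^ Suc (N - Suc l) * (dx ^^ l) v x) = (\<Sum>l<N. D (Suc l) - D l)"
    unfolding D_def by (intro sum.cong refl) (simp add: Suc_diff_Suc del: funpow.simps power_Suc)
  also have "\<dots> = D N - D 0" by (rule sum_lessThan_telescope)
  finally show ?thesis by (simp add: D_def e_def)
qed

lemma has_integral_boundary_form:
  assumes "\<And>l x. l < N \<Longrightarrow> x \<ge> 0 \<Longrightarrow> (dx ^^ l) v differentiable (at x within {0..})" "R \<ge> 0"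
  shows "((\<lambda>x. exp (- \<i> * \<kappa> * of_real x) * ((dx ^^ N) v x - (\<i> * \<kappa>) ^ N * v x))
           has_integral boundary_form N \<kappa> v R - boundary_form N \<kappa> v 0) {0..R}"
  using assms(2)
  by (intro fundamental_theorem_of_calculus
        has_vector_derivative_within_subset[OF has_vector_derivative_boundary_form]) (auto intro: assms(1))

text \<open>The tail is dominated by \<open>M * exp (Im \<kappa> * x)\<close>.  That the error depends on \<open>v\<close> only through its
  bound makes the truncation uniform in time.\<close>
lemma half_fourier_truncation_error:
  assumes cont: "continuous_on {0..} v" and bound: "\<And>x. x \<ge> 0 \<Longrightarrow> norm (v x) \<le> M"
    and "Im \<kappa> < 0" "R \<ge> 0"
  shows "norm (half_fourier v \<kappa> - truncated_fourier R v \<kappa>) \<le> M * (exp (Im \<kappa> * R) / - Im \<kappa>)"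
proof -
  define a where "a = - Im \<kappa>"
  have "a > 0" using assms(3) by (simp add: a_def)
  define h where "h x = exp (- \<i> * \<kappa> * of_real x) * v x" for x
  have norm_h: "norm (h x) \<le> M * exp (- a * x)" if "x \<ge> 0" for x
    using mult_right_mono[OF bound[OF that], of "exp (- a * x)"]
    by (simp add: h_def norm_mult norm_exp_eq_Re a_def mult.commute)
  have cont_h: "continuous_on {0..} h"
    unfolding h_def by (intro continuous_intros cont)
  have "(\<lambda>x. exp (- a * x)) absolutely_integrable_on {0..}"
    by (intro nonnegative_absolutely_integrable_1 integrable_on_exp_minus_to_infinity \<open>a > 0\<close>) auto
  then have "set_integrable lborel {0..} (\<lambda>x. exp (- a * x))"
    unfolding set_integrable_def
    by (subst (asm) integrable_completion)
      (auto intro!: borel_measurable_continuous_on_indicator continuous_intros)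
  then have "set_integrable lborel {0..} (\<lambda>x. M * exp (- a * x))" by simp
  then have int: "set_integrable lborel {0..} h"
  proof (rule set_integrable_bound)
    show "set_borel_measurable lborel {0..} h"
      using set_measurable_continuous_on[OF _ cont_h] by (simp add: set_borel_measurable_def)
    show "AE x in lborel. x \<in> {0..} \<longrightarrow> norm (h x) \<le> norm (M * exp (- a * x))"
      using norm_h by (fastforce intro!: AE_I2 intro: order_trans)
  qed
  have int_on: "h integrable_on {0..}" and half: "half_fourier v \<kappa> = integral {0..} h"
    using set_borel_integral_eq_integral[OF int] by (auto simp: half_fourier_def h_def)
  have int_R: "h integrable_on {R..}"
    using set_borel_integral_eq_integral(1)[OF set_integrable_subset[OF int, of "{R..}"]] \<open>R \<ge> 0\<close> by auto
  have "h integrable_on {0..R}"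
    by (intro integrable_continuous_interval continuous_on_subset[OF cont_h]) auto
  then have "(h has_integral integral {0..R} h + integral {R..} h) ({0..R} \<union> {R..})"
    using int_R
    by (intro has_integral_Un integrable_integral) (auto intro: negligible_subset[of "{R}"])
  also have "{0..R} \<union> {R..} = {0..}" using \<open>R \<ge> 0\<close> by auto
  finally have "half_fourier v \<kappa> - truncated_fourier R v \<kappa> = integral {R..} h"
    using half by (simp add: integral_unique truncated_fourier_def h_def[abs_def])
  also have "norm \<dots> \<le> M * (exp (- a * R) / a)"
  proof -
    have dom: "((\<lambda>x. M * exp (- a * x)) has_integral M * (exp (- a * R) / a)) {R..}"
      by (intro has_integral_mult_right has_integral_exp_minus_to_infinity \<open>a > 0\<close>)
    have "norm (integral {R..} h) \<le> integral {R..} (\<lambda>x. M * exp (- a * x))"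
      using \<open>R \<ge> 0\<close> norm_h
      by (intro integral_norm_bound_integral int_R has_integral_integrable[OF dom]) auto
    then show ?thesis using integral_unique[OF dom] by simp
  qed
  finally show ?thesis by (simp add: a_def)
qed

section \<open>The global relation\<close>

lemma continuous_on_section:
  assumes "continuous_on (A \<times> B) (\<lambda>(s, x). g s x)" "s \<in> A"
  shows "continuous_on B (g s)"
proof -
  have "continuous_on B (\<lambda>x. case (s, x) of (s, x) \<Rightarrow> g s x)"
    by (rule continuous_on_compose2[OF assms(1)]) (use assms(2) in \<open>auto intro!: continuous_intros\<close>)
  then show ?thesis by simp
qed

lemma continuous_on_section':
  assumes "continuous_on (A \<times> B) (\<lambda>(s, x). g s x)" "x \<in> B"
  shows "continuous_on A (\<lambda>s. g s x)"
proof -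
  have "continuous_on A (\<lambda>s. case (s, x) of (s, x) \<Rightarrow> g s x)"
    by (rule continuous_on_compose2[OF assms(1)]) (use assms(2) in \<open>auto intro!: continuous_intros\<close>)
  then show ?thesis by simp
qed

text \<open>For each \<open>x\<close>, the fundamental theorem of calculus in time recovers \<open>exp (- i \<kappa>^N t) * u t x\<close>
  from its time derivative.  Integrating this over \<open>[0, R]\<close> against \<open>exp (- i \<kappa> x)\<close> and exchanging the
  two integrals avoids differentiating the transform under the integral sign.  By the equation, the
  inner space integral is then the transform of \<open>f\<close> plus an exact derivative.\<close>
lemma truncated_global_relation:
  fixes j :: nat and \<kappa> :: complex and u f :: "real \<Rightarrow> real \<Rightarrow> complex"
  defines "N \<equiv> 2*j + 1"
  assumes smooth: "smooth_decaying j T u"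
    and f: "continuous_on ({0..T} \<times> {0..}) (\<lambda>(t, x). f t x)"
    and pde: "\<And>\<tau> x. \<tau> \<in> {0..T} \<Longrightarrow> x \<ge> 0 \<Longrightarrow>
      dt T u \<tau> x + (-1)^(j+1) * (dx ^^ N) (u \<tau>) x = f \<tau> x"
    and "R \<ge> 0" "0 \<le> t" "t \<le> T"
  shows "exp (- \<i> * \<kappa> ^ N * of_real t) * truncated_fourier R (u t) \<kappa> - truncated_fourier R (u 0) \<kappa> =
    integral {0..t} (\<lambda>\<tau>. exp (- \<i> * \<kappa> ^ N * of_real \<tau>) * (truncated_fourier R (f \<tau>) \<kappa> +
      (-1)^j * (boundary_form N \<kappa> (u \<tau>) R - boundary_form N \<kappa> (u \<tau>) 0)))"
proof -
  define \<zeta> where "\<zeta> = \<kappa> ^ N"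
  define e where "e x = exp (- \<i> * \<kappa> * of_real x)" for x
  define E where "E \<tau> = exp (- \<i> * \<zeta> * of_real \<tau>)" for \<tau>
  define G where "G x \<tau> = E \<tau> * e x * (dt T u \<tau> x - \<i> * \<zeta> * u \<tau> x)" for x \<tau>
  have [continuous_intros]: "continuous_on A (\<lambda>z. e (h z))" if "continuous_on A h"
    for A and h :: "'z::topological_space \<Rightarrow> real"
    unfolding e_def by (intro continuous_intros that)
  have [continuous_intros]: "continuous_on A (\<lambda>z. E (h z))" if "continuous_on A h"
    for A and h :: "'z::topological_space \<Rightarrow> real"
    unfolding E_def by (intro continuous_intros that)
  have ut: "continuous_on ({0..T} \<times> {0..}) (\<lambda>(t, x). dt T u t x)"
    and u: "continuous_on ({0..T} \<times> {0..}) (\<lambda>(t, x). u t x)"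
    and diff_t: "\<And>\<tau> x. \<tau> \<in> {0..T} \<Longrightarrow> x \<ge> 0 \<Longrightarrow> (\<lambda>s. u s x) differentiable (at \<tau> within {0..T})"
    and diff_x: "\<And>\<tau> x l. \<tau> \<in> {0..T} \<Longrightarrow> x \<ge> 0 \<Longrightarrow> l < N \<Longrightarrow>
       (dx ^^ l) (u \<tau>) differentiable (at x within {0..})"
    using smooth unfolding smooth_decaying_def N_def by (auto dest: spec[of _ 0])
  (* The integrating factor is chosen so that the two multiples of u cancel. *)
  have symbol: "(-1) ^ j * (\<i> * \<kappa>) ^ N = \<i> * \<zeta>"
  proof -
    have "(-1) ^ j * \<i> ^ N = \<i>"
      by (simp add: N_def power_mult flip: power_mult_distrib)
    then show ?thesis by (simp add: \<zeta>_def power_mult_distrib flip: mult.assoc)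
  qed
  have in_time: "((\<lambda>\<tau>. G x \<tau>) has_integral (E t * (e x * u t x) - e x * u 0 x)) {0..t}"
    if "x \<ge> 0" for x
  proof -
    have "((\<lambda>\<tau>. E \<tau> * u \<tau> x) has_vector_derivative E \<tau> * (dt T u \<tau> x - \<i> * \<zeta> * u \<tau> x))
        (at \<tau> within {0..t})" if "\<tau> \<in> {0..t}" for \<tau>
    proof -
      have 1: "((\<lambda>s. u s x) has_vector_derivative dt T u \<tau> x) (at \<tau> within {0..T})"
        using diff_t[of \<tau> x] that \<open>t \<le> T\<close> \<open>x \<ge> 0\<close> by (simp add: vector_derivative_works dt_def)
      have 2: "(E has_vector_derivative - \<i> * \<zeta> * E \<tau>) (at \<tau> within {0..T})"
        unfolding E_def by (rule has_vector_derivative_exp_mult_of_real)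
      show ?thesis
        using has_vector_derivative_within_subset[OF has_vector_derivative_mult[OF 2 1], of "{0..t}"]
          \<open>t \<le> T\<close> by (simp add: algebra_simps)
    qed
    from fundamental_theorem_of_calculus[OF \<open>0 \<le> t\<close> this]
    have "((\<lambda>\<tau>. E \<tau> * (dt T u \<tau> x - \<i> * \<zeta> * u \<tau> x)) has_integral (E t * u t x - E 0 * u 0 x)) {0..t}" .
    from has_integral_mult_right[OF this, of "e x"] show ?thesis
      by (simp add: G_def E_def algebra_simps)
  qed
  have in_space: "integral {0..R} (\<lambda>x. G x \<tau>) = E \<tau> * (truncated_fourier R (f \<tau>) \<kappa> +
      (-1)^j * (boundary_form N \<kappa> (u \<tau>) R - boundary_form N \<kappa> (u \<tau>) 0))"
    if \<tau>: "\<tau> \<in> {0..t}" for \<tau>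
  proof -
    have "\<tau> \<in> {0..T}" using \<tau> \<open>t \<le> T\<close> by auto
    have "((\<lambda>x. e x * ((dx ^^ N) (u \<tau>) x - (\<i> * \<kappa>) ^ N * u \<tau> x)) has_integral
           boundary_form N \<kappa> (u \<tau>) R - boundary_form N \<kappa> (u \<tau>) 0) {0..R}"
      unfolding e_def using diff_x[OF \<open>\<tau> \<in> {0..T}\<close>] \<open>R \<ge> 0\<close>
      by (intro has_integral_boundary_form) auto
    moreover have "((\<lambda>x. e x * f \<tau> x) has_integral truncated_fourier R (f \<tau>) \<kappa>) {0..R}"
      unfolding truncated_fourier_def e_def
      by (intro integrable_integral integrable_continuous_interval continuous_intros
            continuous_on_subset[OF continuous_on_section[OF f \<open>\<tau> \<in> {0..T}\<close>]]) auto
    ultimately have integral: "((\<lambda>x. E \<tau> * (e x * f \<tau> x +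
          (-1)^j * (e x * ((dx ^^ N) (u \<tau>) x - (\<i> * \<kappa>) ^ N * u \<tau> x)))) has_integral
        E \<tau> * (truncated_fourier R (f \<tau>) \<kappa> +
      (-1)^j * (boundary_form N \<kappa> (u \<tau>) R - boundary_form N \<kappa> (u \<tau>) 0))) {0..R}"
      by (intro has_integral_mult_right has_integral_add)
    have "E \<tau> * (e x * f \<tau> x +
          (-1)^j * (e x * ((dx ^^ N) (u \<tau>) x - (\<i> * \<kappa>) ^ N * u \<tau> x))) = G x \<tau>" if "x \<in> {0..R}" for x
    proof -
      have "f \<tau> x + (-1)^j * ((dx ^^ N) (u \<tau>) x - (\<i> * \<kappa>) ^ N * u \<tau> x) =
            f \<tau> x + (-1)^j * (dx ^^ N) (u \<tau>) x - (-1) ^ j * (\<i> * \<kappa>) ^ N * u \<tau> x"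
        by (simp add: right_diff_distrib)
      also have "\<dots> = dt T u \<tau> x - \<i> * \<zeta> * u \<tau> x"
        unfolding symbol using pde[OF \<open>\<tau> \<in> {0..T}\<close>, of x] that by (simp add: diff_eq_eq)
      finally have "E \<tau> * e x * (f \<tau> x + (-1)^j * ((dx ^^ N) (u \<tau>) x - (\<i> * \<kappa>) ^ N * u \<tau> x)) = G x \<tau>"
        by (simp only: G_def)
      then show ?thesis by (simp only: distrib_left mult_ac)
    qed
    from has_integral_eq[OF this integral] show ?thesis by (rule integral_unique)
  qed
  have "continuous_on (cbox (0, 0) (R, t)) (\<lambda>(x, \<tau>). G x \<tau>)"
  proof -
    have swap: "continuous_on (cbox (0, 0) (R, t)) (\<lambda>z. g (snd z) (fst z))"
      if "continuous_on ({0..T} \<times> {0..}) (\<lambda>(s, x). g s x)" for g :: "real \<Rightarrow> real \<Rightarrow> complex"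
    proof -
      have "continuous_on (cbox (0, 0) (R, t)) (\<lambda>z. case (snd z, fst z) of (s, x) \<Rightarrow> g s x)"
        by (rule continuous_on_compose2[OF that])
          (use \<open>t \<le> T\<close> in \<open>auto intro!: continuous_intros simp: cbox_Pair_eq\<close>)
      then show ?thesis by simp
    qed
    show ?thesis unfolding G_def case_prod_unfold
      by (intro continuous_intros swap[OF u] swap[OF ut])
  qed
  from integral_swap_continuous[OF this]
  have "integral {0..R} (\<lambda>x. integral {0..t} (G x)) = integral {0..t} (\<lambda>\<tau>. integral {0..R} (\<lambda>x. G x \<tau>))"
    by simp
  also have "integral {0..R} (\<lambda>x. integral {0..t} (G x)) =
      integral {0..R} (\<lambda>x. E t * (e x * u t x) - e x * u 0 x)"
    by (intro integral_cong integral_unique in_time) auto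
  also have "\<dots> = E t * truncated_fourier R (u t) \<kappa> - truncated_fourier R (u 0) \<kappa>"
  proof -
    have "(\<lambda>x. e x * u \<tau> x) integrable_on {0..R}" if "\<tau> \<in> {0..T}" for \<tau>
      by (intro integrable_continuous_interval continuous_intros
            continuous_on_subset[OF continuous_on_section[OF u that]]) auto
    then show ?thesis using \<open>0 \<le> t\<close> \<open>t \<le> T\<close>
      unfolding truncated_fourier_def e_def[symmetric]
      by (subst integral_diff) (auto intro: integrable_on_mult_right)
  qed
  also have "integral {0..t} (\<lambda>\<tau>. integral {0..R} (\<lambda>x. G x \<tau>)) =
    integral {0..t} (\<lambda>\<tau>. E \<tau> * (truncated_fourier R (f \<tau>) \<kappa> +
      (-1)^j * (boundary_form N \<kappa> (u \<tau>) R - boundary_form N \<kappa> (u \<tau>) 0)))"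
    by (intro integral_cong in_space)
  finally show ?thesis unfolding E_def \<zeta>_def .
qed

text \<open>Decay controls large \<open>x\<close> uniformly in time, and compactness the remaining rectangle.\<close>
lemma bounded_if_continuous_decaying:
  fixes g :: "real \<Rightarrow> real \<Rightarrow> complex"
  assumes cont: "continuous_on ({0..T} \<times> {0..}) (\<lambda>(t, x). g t x)"
    and decay: "uniform_limit {0..T} (\<lambda>x t. g t x) (\<lambda>_. 0) at_top"
  obtains M :: real where "\<And>t x. t \<in> {0..T} \<Longrightarrow> x \<ge> 0 \<Longrightarrow> norm (g t x) \<le> M"
proof -
  have "\<exists>r. \<forall>x\<ge>r. \<forall>t\<in>{0..T}. dist (g t x) 0 < 1"
    using uniform_limitD[OF decay, of 1] by (simp only: eventually_at_top_linorder zero_less_one)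
  then obtain r where r_dist: "\<forall>x\<ge>r. \<forall>t\<in>{0..T}. dist (g t x) 0 < 1" by blast
  have r: "norm (g t x) < 1" if "x \<ge> r" "t \<in> {0..T}" for x t
    using r_dist that by simp
  have "continuous_on ({0..T} \<times> {0..r}) (\<lambda>(t, x). g t x)"
    by (rule continuous_on_subset[OF cont]) auto
  then have "bounded ((\<lambda>(t, x). g t x) ` ({0..T} \<times> {0..r}))"
    by (intro compact_imp_bounded compact_continuous_image compact_Times) auto
  then obtain B where B: "\<And>t x. t \<in> {0..T} \<Longrightarrow> x \<in> {0..r} \<Longrightarrow> norm (g t x) \<le> B"
    by (force simp: bounded_iff)
  show thesis
  proof
    show "norm (g t x) \<le> max 1 B" if "t \<in> {0..T}" "x \<ge> 0" for t x
      using r[of x t] B[of t x] that by (cases "x \<le> r") (auto simp: le_max_iff_disj)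
  qed
qed

lemma uniform_limit_exp_bound:
  assumes "a < 0" and "\<And>n \<tau>. \<tau> \<in> S \<Longrightarrow> norm (h n \<tau> - l \<tau>) \<le> C * exp (a * real n)"
  shows "uniform_limit S h l sequentially"
proof (rule uniform_limitI)
  fix e :: real assume "e > 0"
  have "(\<lambda>n. C * exp (a * real n)) \<longlonglongrightarrow> 0"
    using \<open>a < 0\<close>
    by (intro tendsto_mult_right_zero) (simp add: exp_of_nat2_mult LIMSEQ_realpow_zero)
  then have "\<forall>\<^sub>F n in sequentially. C * exp (a * real n) < e"
    using \<open>e > 0\<close> by (rule order_tendstoD)
  then show "\<forall>\<^sub>F n in sequentially. \<forall>\<tau>\<in>S. dist (h n \<tau>) (l \<tau>) < e"
    by eventually_elim (metis assms(2) dist_norm le_less_trans)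
qed

lemma time_transform_eq_integral:
  assumes "continuous_on {0..t} h"
  shows "time_transform h t \<zeta> = integral {0..t} (\<lambda>\<tau>. exp (- \<i> * \<zeta> * of_real \<tau>) * h \<tau>)"
    and "(\<lambda>\<tau>. exp (- \<i> * \<zeta> * of_real \<tau>) * h \<tau>) integrable_on {0..t}"
proof -
  have "set_integrable lborel {0..t} (\<lambda>\<tau>. exp (- \<i> * \<zeta> * of_real \<tau>) * h \<tau>)"
    by (intro borel_integrable_atLeastAtMost' continuous_intros assms)
  from set_borel_integral_eq_integral[OF this]
  show "time_transform h t \<zeta> = integral {0..t} (\<lambda>\<tau>. exp (- \<i> * \<zeta> * of_real \<tau>) * h \<tau>)"
    and "(\<lambda>\<tau>. exp (- \<i> * \<zeta> * of_real \<tau>) * h \<tau>) integrable_on {0..t}"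
    by (simp_all add: time_transform_def)
qed

lemma time_transform_add:
  assumes "continuous_on {0..t} g" "continuous_on {0..t} h"
  shows "time_transform (\<lambda>\<tau>. g \<tau> + h \<tau>) t \<zeta> = time_transform g t \<zeta> + time_transform h t \<zeta>"
  using assms
  by (simp only: time_transform_eq_integral continuous_on_add distrib_left integral_add)

lemma time_transform_mult_left: "time_transform (\<lambda>\<tau>. c * h \<tau>) t \<zeta> = c * time_transform h t \<zeta>"
  unfolding time_transform_def by (simp add: mult.left_commute)

lemma time_transform_sum:
  assumes "\<And>l. l \<in> A \<Longrightarrow> continuous_on {0..t} (h l)"
  shows "time_transform (\<lambda>\<tau>. \<Sum>l\<in>A. h l \<tau>) t \<zeta> = (\<Sum>l\<in>A. time_transform (h l) t \<zeta>)"
  using assms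
proof (induction A rule: infinite_finite_induct)
  case (insert a A)
  then show ?case by (simp add: time_transform_add continuous_on_sum)
qed (simp_all add: time_transform_def)

text \<open>The limit \<open>R \<rightarrow> \<infinity>\<close> of the truncated relation, taken along the natural numbers.  All
  truncation errors, including the boundary terms at \<open>x = R\<close>, are \<open>O(exp (Im \<kappa> * R))\<close> uniformly in
  time, so the limit may be taken under the time integral, and the transform of \<open>f\<close> is continuous
  in time.\<close>
lemma global_relation:
  fixes j :: nat and \<kappa> :: complex and u f :: "real \<Rightarrow> real \<Rightarrow> complex"
  defines "N \<equiv> 2*j + 1"
  assumes smooth: "smooth_decaying j T u"
    and f: "continuous_on ({0..T} \<times> {0..}) (\<lambda>(t, x). f t x)"
    and f_decay: "uniform_limit {0..T} (\<lambda>x t. f t x) (\<lambda>_. 0) at_top"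
    and pde: "\<And>\<tau> x. \<tau> \<in> {0..T} \<Longrightarrow> x \<ge> 0 \<Longrightarrow>
      dt T u \<tau> x + (-1)^(j+1) * (dx ^^ N) (u \<tau>) x = f \<tau> x"
    and "Im \<kappa> < 0" "0 \<le> t" "t \<le> T"
  shows "(\<Sum>l<N. (\<i> * \<kappa>) ^ (N - Suc l) * g_tilde u l t (\<kappa> ^ N)) =
    (-1)^j * (- exp (- \<i> * \<kappa> ^ N * of_real t) * half_fourier (u t) \<kappa> + half_fourier (u 0) \<kappa>
              + F j f t \<kappa>)"
proof -
  define a where "a = Im \<kappa>"
  have "a < 0" using assms by (simp add: a_def)
  define E where "E \<tau> = exp (- \<i> * \<kappa> ^ N * of_real \<tau>)" for \<tau>
  have cont_E: "continuous_on {0..t} E" unfolding E_def by (intro continuous_intros)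
  have u_cont: "continuous_on ({0..T} \<times> {0..}) (\<lambda>(t, x). (dx ^^ l) (u t) x)"
    and u_decay: "uniform_limit {0..T} (\<lambda>x t. (dx ^^ l) (u t) x) (\<lambda>_. 0) at_top" if "l < N" for l
    using smooth that unfolding smooth_decaying_def N_def by auto
  note sub = continuous_on_subset[where s = "{0..T}" and t = "{0..t}"]
  have "\<exists>M. \<forall>\<tau>\<in>{0..T}. \<forall>x\<ge>0. norm ((dx ^^ l) (u \<tau>) x) \<le> M" if "l < N" for l
    using bounded_if_continuous_decaying[OF u_cont[OF that] u_decay[OF that]] by metis
  then obtain M where M: "\<And>l \<tau> x. l < N \<Longrightarrow> \<tau> \<in> {0..T} \<Longrightarrow> x \<ge> 0 \<Longrightarrow> norm ((dx ^^ l) (u \<tau>) x) \<le> M l"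
    by metis
  obtain Mf where Mf: "\<And>\<tau> x. \<tau> \<in> {0..T} \<Longrightarrow> x \<ge> 0 \<Longrightarrow> norm (f \<tau> x) \<le> Mf"
    using bounded_if_continuous_decaying[OF f f_decay] by metis

  have lim_fourier: "uniform_limit {0..T} (\<lambda>n \<tau>. truncated_fourier (real n) (g \<tau>) \<kappa>)
      (\<lambda>\<tau>. half_fourier (g \<tau>) \<kappa>) sequentially"
    if g: "continuous_on ({0..T} \<times> {0..}) (\<lambda>(t, x). g t x)"
      and B: "\<And>\<tau> x. \<tau> \<in> {0..T} \<Longrightarrow> x \<ge> 0 \<Longrightarrow> norm (g \<tau> x) \<le> B" for g B
  proof (rule uniform_limit_exp_bound[OF \<open>a < 0\<close>])
    show "norm (truncated_fourier (real n) (g \<tau>) \<kappa> - half_fourier (g \<tau>) \<kappa>) \<le> B / - a * exp (a * real n)"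
      if "\<tau> \<in> {0..T}" for n \<tau>
      using half_fourier_truncation_error[OF continuous_on_section[OF g that], of B \<kappa> "real n"]
        B[OF that] \<open>Im \<kappa> < 0\<close>
      by (simp add: a_def norm_minus_commute)
  qed
  have lim_u: "(\<lambda>n. truncated_fourier (real n) (u \<tau>) \<kappa>) \<longlonglongrightarrow> half_fourier (u \<tau>) \<kappa>"
    if "\<tau> \<in> {0..T}" for \<tau>
  proof (rule tendsto_uniform_limitI[OF lim_fourier that])
    show "continuous_on ({0..T} \<times> {0..}) (\<lambda>(t, x). u t x)" using u_cont[of 0] by (simp add: N_def)
    show "norm (u \<tau> x) \<le> M 0" if "\<tau> \<in> {0..T}" "x \<ge> 0" for \<tau> x
      using M[of 0 \<tau> x] that by (simp add: N_def)
  qed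
  have lim_f: "uniform_limit {0..T} (\<lambda>n \<tau>. truncated_fourier (real n) (f \<tau>) \<kappa>)
      (\<lambda>\<tau>. half_fourier (f \<tau>) \<kappa>) sequentially"
    by (rule lim_fourier[OF f Mf])
  have lim_bdry: "uniform_limit {0..T} (\<lambda>n \<tau>. boundary_form N \<kappa> (u \<tau>) (real n)) (\<lambda>_. 0) sequentially"
  proof (rule uniform_limit_exp_bound[OF \<open>a < 0\<close>])
    fix n \<tau> assume \<tau>: "\<tau> \<in> {0..T}"
    have "norm (\<Sum>l<N. (\<i> * \<kappa>) ^ (N - Suc l) * (dx ^^ l) (u \<tau>) (real n)) \<le>
        (\<Sum>l<N. norm \<kappa> ^ (N - Suc l) * M l)"
      using M[OF _ \<tau>] by (intro sum_norm_le) (auto simp: norm_mult norm_power intro!: mult_left_mono)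
    then show "norm (boundary_form N \<kappa> (u \<tau>) (real n) - 0) \<le>
        (\<Sum>l<N. norm \<kappa> ^ (N - Suc l) * M l) * exp (a * real n)"
      unfolding boundary_form_def by (simp add: norm_mult norm_exp_eq_Re a_def mult.commute)
  qed

  have cont_tf: "continuous_on {0..T} (\<lambda>\<tau>. truncated_fourier (real n) (f \<tau>) \<kappa>)" for n
  proof -
    have "continuous_on ({0..T} \<times> cbox 0 (real n)) (\<lambda>(\<tau>, x). f \<tau> x)"
      by (rule continuous_on_subset[OF f]) auto
    then have "continuous_on ({0..T} \<times> cbox 0 (real n)) (\<lambda>(\<tau>, x). exp (- \<i> * \<kappa> * of_real x) * f \<tau> x)"
      unfolding case_prod_unfold by (intro continuous_intros)
    from integral_continuous_on_param[OF this] show ?thesis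
      by (simp add: truncated_fourier_def)
  qed
  have cont_hf: "continuous_on {0..T} (\<lambda>\<tau>. half_fourier (f \<tau>) \<kappa>)"
    by (rule uniform_limit_theorem[OF _ lim_f]) (auto simp: cont_tf)
  have cont_u: "continuous_on {0..T} (\<lambda>\<tau>. (dx ^^ l) (u \<tau>) x)" if "x \<ge> 0" "l < N" for x l
    using continuous_on_section'[OF u_cont[OF \<open>l < N\<close>]] that by simp
  have cont_b: "continuous_on {0..T} (\<lambda>\<tau>. boundary_form N \<kappa> (u \<tau>) x)" if "x \<ge> 0" for x
    unfolding boundary_form_def using that by (intro continuous_intros cont_u) auto

  define H where "H n \<tau> = E \<tau> * (truncated_fourier (real n) (f \<tau>) \<kappa> +
      (-1)^j * (boundary_form N \<kappa> (u \<tau>) (real n) - boundary_form N \<kappa> (u \<tau>) 0))" for n \<tau>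
  define H' where "H' \<tau> = E \<tau> * (half_fourier (f \<tau>) \<kappa> + (-1)^j * (0 - boundary_form N \<kappa> (u \<tau>) 0))" for \<tau>
  have "uniform_limit {0..t} H H' sequentially"
    unfolding H_def[abs_def] H'_def[abs_def]
  proof (rule uniform_lim_mult)
    show "uniform_limit {0..t} (\<lambda>n \<tau>. truncated_fourier (real n) (f \<tau>) \<kappa> +
      (-1)^j * (boundary_form N \<kappa> (u \<tau>) (real n) - boundary_form N \<kappa> (u \<tau>) 0))
      (\<lambda>\<tau>. half_fourier (f \<tau>) \<kappa> + (-1)^j * (0 - boundary_form N \<kappa> (u \<tau>) 0)) sequentially"
      using \<open>t \<le> T\<close>
      by (intro uniform_limit_intros uniform_limit_on_subset[OF lim_f] uniform_limit_on_subset[OF lim_bdry]) auto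
    show "bounded (E ` {0..t})"
      by (intro compact_imp_bounded compact_continuous_image cont_E compact_Icc)
    show "bounded ((\<lambda>\<tau>. half_fourier (f \<tau>) \<kappa> + (-1)^j * (0 - boundary_form N \<kappa> (u \<tau>) 0)) ` {0..t})"
      using \<open>t \<le> T\<close>
      by (intro compact_imp_bounded compact_continuous_image compact_Icc continuous_intros
          sub[OF cont_hf] sub[OF cont_b]) auto
  qed (rule uniform_limit_const)
  moreover have "continuous_on {0..t} (H n)" for n
    unfolding H_def[abs_def] using \<open>t \<le> T\<close>
    by (intro continuous_intros cont_E sub[OF cont_tf] sub[OF cont_b]) auto
  ultimately obtain I J where IJ: "\<And>n. (H n has_integral I n) {0..t}" "(H' has_integral J) {0..t}"
      "I \<longlonglongrightarrow> J"
    using uniform_limit_integral[where f=H and g=H' and a=0 and b=t and F=sequentially] by auto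
  have "I n = E t * truncated_fourier (real n) (u t) \<kappa> - truncated_fourier (real n) (u 0) \<kappa>" for n
    using truncated_global_relation[OF smooth f pde[unfolded N_def], of "real n" t \<kappa>] IJ(1)[of n] \<open>0 \<le> t\<close> \<open>t \<le> T\<close>
    unfolding H_def E_def N_def by (simp add: integral_unique)
  then have "I = (\<lambda>n. E t * truncated_fourier (real n) (u t) \<kappa> - truncated_fourier (real n) (u 0) \<kappa>)"
    by (rule ext)
  then have "I \<longlonglongrightarrow> E t * half_fourier (u t) \<kappa> - half_fourier (u 0) \<kappa>"
    using \<open>0 \<le> t\<close> \<open>t \<le> T\<close> by (auto intro!: tendsto_intros lim_u)
  then have J: "J = E t * half_fourier (u t) \<kappa> - half_fourier (u 0) \<kappa>"
    by (rule LIMSEQ_unique[OF IJ(3)])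
  have "J = integral {0..t} (\<lambda>\<tau>. E \<tau> * (half_fourier (f \<tau>) \<kappa> +
      (\<Sum>l<N. - ((-1)^j * (\<i> * \<kappa>) ^ (N - Suc l)) * (dx ^^ l) (u \<tau>) 0)))"
    using integral_unique[OF IJ(2)] unfolding H'_def boundary_form_def
    by (simp add: sum_distrib_left sum_negf mult.assoc)
  also have "\<dots> = time_transform (\<lambda>\<tau>. half_fourier (f \<tau>) \<kappa> +
      (\<Sum>l<N. - ((-1)^j * (\<i> * \<kappa>) ^ (N - Suc l)) * (dx ^^ l) (u \<tau>) 0)) t (\<kappa> ^ N)"
    unfolding E_def using \<open>t \<le> T\<close>
    by (intro time_transform_eq_integral(1)[symmetric] continuous_intros sub[OF cont_hf] sub[OF cont_u]) auto
  also have "\<dots> = F j f t \<kappa> + time_transform (\<lambda>\<tau>. \<Sum>l<N. - ((-1)^j * (\<i> * \<kappa>) ^ (N - Suc l)) *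
      (dx ^^ l) (u \<tau>) 0) t (\<kappa> ^ N)"
    unfolding F_def N_def[symmetric] using \<open>t \<le> T\<close>
    by (intro time_transform_add continuous_intros sub[OF cont_hf] sub[OF cont_u]) auto
  also have "time_transform (\<lambda>\<tau>. \<Sum>l<N. - ((-1)^j * (\<i> * \<kappa>) ^ (N - Suc l)) *
      (dx ^^ l) (u \<tau>) 0) t (\<kappa> ^ N) =
      (\<Sum>l<N. - ((-1)^j * (\<i> * \<kappa>) ^ (N - Suc l)) * g_tilde u l t (\<kappa> ^ N))"
    unfolding g_tilde_def time_transform_mult_left[symmetric] using \<open>t \<le> T\<close>
    by (intro time_transform_sum continuous_intros sub[OF cont_u]) auto
  also have "(\<Sum>l<N. - ((-1)^j * (\<i> * \<kappa>) ^ (N - Suc l)) * g_tilde u l t (\<kappa> ^ N)) =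
      - ((-1)^j * (\<Sum>l<N. (\<i> * \<kappa>) ^ (N - Suc l) * g_tilde u l t (\<kappa> ^ N)))"
    by (simp only: sum_distrib_left sum_negf mult.assoc mult_minus_left)
  finally have "(-1)^j * (E t * half_fourier (u t) \<kappa> - half_fourier (u 0) \<kappa>) =
     (-1)^j * F j f t \<kappa> - (\<Sum>l<N. (\<i> * \<kappa>) ^ (N - Suc l) * g_tilde u l t (\<kappa> ^ N))"
    unfolding J by (simp add: right_diff_distrib flip: mult.assoc)
  then show ?thesis unfolding E_def by (simp add: algebra_simps)
qed

section \<open>Elimination of the boundary values\<close>

text \<open>The equation and the boundary and initial conditions are prescribed on open sets only; both sides
  being continuous up to the boundary, they persist on the closure.\<close>
lemma pde_on_closure:
  assumes "T > 0" "smooth_decaying j T u" "admissible_data j T f u0 \<phi>" "solves_ibvp j \<gamma> T f u0 \<phi> u"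
    and "\<tau> \<in> {0..T}" "x \<ge> 0"
  shows "dt T u \<tau> x + (-1)^(j+1) * (dx ^^ (2*j+1)) (u \<tau>) x = f \<tau> x"
proof -
  let ?S = "{0<..<T} \<times> {0::real<..}"
  let ?h = "\<lambda>z. (case z of (t, x) \<Rightarrow> dt T u t x) + (-1)^(j+1) * (case z of (t, x) \<Rightarrow> (dx ^^ (2*j+1)) (u t) x)
     - (case z of (t, x) \<Rightarrow> f t x)"
  have cl: "closure ?S = {0..T} \<times> {0..}" using \<open>T > 0\<close> by (simp add: closure_Times)
  have "?h (\<tau>, x) = 0"
  proof (rule continuous_constant_on_closure[of ?S])
    show "continuous_on (closure ?S) ?h" unfolding cl
      using assms(2,3) unfolding smooth_decaying_def admissible_data_def
      by (intro continuous_intros) auto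
    show "?h z = 0" if "z \<in> ?S" for z
      using assms(4) that unfolding solves_ibvp_def by auto
    show "(\<tau>, x) \<in> closure ?S" unfolding cl using assms by simp
  qed
  then show ?thesis by simp
qed

lemma boundary_condition_on_closure:
  assumes "T > 0" "smooth_decaying j T u" "admissible_data j T f u0 \<phi>" "solves_ibvp j \<gamma> T f u0 \<phi> u"
    and "\<tau> \<in> {0..T}" "l < j"
  shows "(dx ^^ Suc l) (u \<tau>) 0 + of_real \<gamma> * (dx ^^ l) (u \<tau>) 0 = \<phi> (Suc l) \<tau>"
proof -
  let ?h = "\<lambda>\<tau>. (dx ^^ Suc l) (u \<tau>) 0 + of_real \<gamma> * (dx ^^ l) (u \<tau>) 0 - \<phi> (Suc l) \<tau>"
  have cl: "closure {0<..<T} = {0..T}" using \<open>T > 0\<close> by simp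
  have "?h \<tau> = 0"
  proof (rule continuous_constant_on_closure[of "{0<..<T}"])
    have "continuous_on {0..T} (\<lambda>\<tau>. (dx ^^ m) (u \<tau>) 0)" if "m \<le> j" for m
      by (rule continuous_on_section'[where B = "{0..}"])
        (use assms(2) that in \<open>auto simp: smooth_decaying_def\<close>)
    from this[of l] this[of "Suc l"]
    show "continuous_on (closure {0<..<T}) ?h"
      unfolding cl using assms(3,6) unfolding admissible_data_def
      by (intro continuous_intros) auto
    show "?h \<tau> = 0" if "\<tau> \<in> {0<..<T}" for \<tau>
      using assms(4,6) that unfolding solves_ibvp_def by (auto dest!: bspec[of _ _ "Suc l"])
    show "\<tau> \<in> closure {0<..<T}" unfolding cl by (rule assms(5))
  qed
  then show ?thesis by simp
qed

lemma half_fourier_initial: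
  assumes "T > 0" "smooth_decaying j T u" "admissible_data j T f u0 \<phi>" "solves_ibvp j \<gamma> T f u0 \<phi> u"
  shows "half_fourier (u 0) \<kappa> = half_fourier u0 \<kappa>"
proof -
  have cont: "continuous_on {0..} (u 0)"
    by (rule continuous_on_section[where A = "{0..T}"])
      (use assms(1,2) in \<open>auto simp: smooth_decaying_def dest: spec[of _ 0]\<close>)
  have "u 0 x - u0 x = 0" if "x \<ge> 0" for x
  proof (rule continuous_constant_on_closure[of "{0<..}" "\<lambda>x. u 0 x - u0 x"])
    show "continuous_on (closure {0<..}) (\<lambda>x. u 0 x - u0 x)"
      using assms(3) unfolding admissible_data_def by (auto intro!: continuous_intros cont)
  qed (use assms(4) that in \<open>auto simp: solves_ibvp_def\<close>)
  then show ?thesis unfolding half_fourier_def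
    by (intro set_lebesgue_integral_cong) auto
qed

text \<open>At \<open>l = j\<close> this uses that \<open>\<bb> j \<gamma> (Suc j) \<kappa>\<close> is an empty sum.\<close>
lemma \<bb>_recurrence:
  assumes "l \<le> j"
  shows "\<bb> j \<gamma> l \<kappa> + of_real \<gamma> * \<bb> j \<gamma> (Suc l) \<kappa> = (\<i> * \<kappa>) ^ (2*j - l)"
proof -
  have "\<bb> j \<gamma> l \<kappa> = (\<i> * \<kappa>) ^ (2*j - l) +
      (\<Sum>q=Suc l..j. (\<i> * \<kappa>) ^ (2*j - q) * (- of_real \<gamma>) ^ (q - l))"
    unfolding \<bb>_def using assms by (subst sum.atLeast_Suc_atMost) auto
  also have "(\<Sum>q=Suc l..j. (\<i> * \<kappa>) ^ (2*j - q) * (- of_real \<gamma>) ^ (q - l)) = - of_real \<gamma> * \<bb> j \<gamma> (Suc l) \<kappa>"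
    unfolding \<bb>_def sum_distrib_left
  proof (intro sum.cong refl)
    fix q assume "q \<in> {Suc l..j}"
    then have "q - l = Suc (q - Suc l)" by auto
    then show "(\<i> * \<kappa>) ^ (2*j - q) * (- of_real \<gamma>) ^ (q - l) =
        - of_real \<gamma> * ((\<i> * \<kappa>) ^ (2*j - q) * (- of_real \<gamma>) ^ (q - Suc l))"
      by simp
  qed
  finally show ?thesis by simp
qed

text \<open>Summation by parts: inserting \<open>\<bb>_recurrence\<close> and shifting the index of its second term gathers
  at \<open>\<bb> j \<gamma> (Suc l) \<kappa>\<close> exactly the combination that the boundary condition prescribes.\<close>
lemma boundary_terms_elimination:
  assumes "\<And>l. l < j \<Longrightarrow> g (Suc l) + of_real \<gamma> * g l = h (Suc l)"
  shows "(\<Sum>l\<le>j. (\<i> * \<kappa>) ^ (2*j - l) * g l) = \<bb> j \<gamma> 0 \<kappa> * g 0 + (\<Sum>l=1..j. \<bb> j \<gamma> l \<kappa> * h l)"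
proof -
  let ?b = "\<lambda>l. \<bb> j \<gamma> l \<kappa>"
  have "(\<Sum>l\<le>j. (\<i> * \<kappa>) ^ (2*j - l) * g l) = (\<Sum>l\<le>j. ?b l * g l) + (\<Sum>l\<le>j. of_real \<gamma> * ?b (Suc l) * g l)"
    unfolding sum.distrib[symmetric] distrib_right[symmetric]
    by (intro sum.cong refl) (simp only: \<bb>_recurrence atMost_iff)
  also have "(\<Sum>l\<le>j. ?b l * g l) = ?b 0 * g 0 + (\<Sum>l<j. ?b (Suc l) * g (Suc l))"
    by (simp add: sum.atMost_shift)
  also have "(\<Sum>l\<le>j. of_real \<gamma> * ?b (Suc l) * g l) = (\<Sum>l<j. of_real \<gamma> * ?b (Suc l) * g l)"
    by (simp add: \<bb>_def[of j \<gamma> "Suc j"] flip: lessThan_Suc_atMost)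
  finally have "(\<Sum>l\<le>j. (\<i> * \<kappa>) ^ (2*j - l) * g l) =
      ?b 0 * g 0 + (\<Sum>l<j. ?b (Suc l) * (g (Suc l) + of_real \<gamma> * g l))"
    by (simp add: sum.distrib algebra_simps)
  also have "(\<Sum>l<j. ?b (Suc l) * (g (Suc l) + of_real \<gamma> * g l)) = (\<Sum>l=1..j. ?b l * h l)"
    by (simp add: assms sum.atLeast1_atMost_eq)
  finally show ?thesis .
qed

lemma sum_split_reflect:
  fixes h :: "nat \<Rightarrow> 'a :: comm_monoid_add"
  shows "(\<Sum>l<2*j+1. h l) = (\<Sum>l\<le>j. h l) + (\<Sum>m<j. h (2*j - m))"
proof -
  have "(\<Sum>m<j. h (2*j - m)) = (\<Sum>l\<in>{j<..<2*j+1}. h l)"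
    by (rule sum.reindex_bij_witness[of _ "\<lambda>l. 2*j - l" "\<lambda>m. 2*j - m"]) auto
  moreover have "(\<Sum>l<2*j+1. h l) = (\<Sum>l\<in>{..j} \<union> {j<..<2*j+1}. h l)"
    by (rule sum.cong) auto
  moreover have "\<dots> = (\<Sum>l\<le>j. h l) + (\<Sum>l\<in>{j<..<2*j+1}. h l)"
    by (rule sum.union_disjoint) auto
  ultimately show ?thesis by (simp only:)
qed

text \<open>The global relation at \<open>\<kappa> = \<alpha>_n * k\<close>: the boundary values of order at most \<open>j\<close> are eliminated,
  those of order \<open>2j - m\<close> with \<open>m < j\<close> are kept as the unknowns \<open>X_(m+1)\<close>.\<close>
lemma \<I>_eq_unknowns:
  assumes "T > 0" "smooth_decaying j T u" "admissible_data j T f u0 \<phi>" "solves_ibvp j \<gamma> T f u0 \<phi> u"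
    and "0 \<le> t" "t \<le> T" and Im: "Im (\<alpha> j p n * k) < 0"
  shows "\<I> j \<gamma> f u0 \<phi> u p n t k =
    (\<Sum>m<j. \<alpha> j p n ^ m * X j u t k (m+1)) +
    \<bb> j \<gamma> 0 (\<alpha> j p n * k) * g_tilde u 0 t (k ^ (2*j+1))"
proof -
  define \<kappa> where "\<kappa> = \<alpha> j p n * k"
  define \<zeta> where "\<zeta> = k ^ (2*j+1)"
  have \<zeta>: "\<kappa> ^ (2*j+1) = \<zeta>"
    unfolding \<kappa>_def \<zeta>_def power_mult_distrib \<alpha>_power_order by simp
  have u_cont: "continuous_on {0..t} (\<lambda>\<tau>. (dx ^^ l) (u \<tau>) 0)" if "l \<le> j" for l
    by (rule continuous_on_section'[where B = "{0..}"], rule continuous_on_subset[where s = "{0..T} \<times> {0..}"])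
      (use assms(2,6) that in \<open>auto simp: smooth_decaying_def\<close>)
  have "g_tilde u (Suc l) t \<zeta> + of_real \<gamma> * g_tilde u l t \<zeta> = time_transform (\<phi> (Suc l)) t \<zeta>" if "l < j" for l
  proof -
    have "time_transform (\<phi> (Suc l)) t \<zeta> =
        time_transform (\<lambda>\<tau>. (dx ^^ Suc l) (u \<tau>) 0 + of_real \<gamma> * (dx ^^ l) (u \<tau>) 0) t \<zeta>"
      unfolding time_transform_def using boundary_condition_on_closure[OF assms(1-4) _ that] \<open>t \<le> T\<close>
      by (intro set_lebesgue_integral_cong) auto
    also have "\<dots> = g_tilde u (Suc l) t \<zeta> + of_real \<gamma> * g_tilde u l t \<zeta>"
      unfolding g_tilde_def time_transform_mult_left[symmetric] using that
      by (intro time_transform_add continuous_on_mult_left u_cont) auto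
    finally show ?thesis by simp
  qed
  from boundary_terms_elimination[of j "\<lambda>l. g_tilde u l t \<zeta>", OF this]
  have elim: "(\<Sum>l\<le>j. (\<i> * \<kappa>) ^ (2*j - l) * g_tilde u l t \<zeta>) =
      \<bb> j \<gamma> 0 \<kappa> * g_tilde u 0 t \<zeta> + (\<Sum>l=1..j. \<bb> j \<gamma> l \<kappa> * time_transform (\<phi> l) t \<zeta>)" .
  have f: "continuous_on ({0..T} \<times> {0..}) (\<lambda>(t, x). f t x)"
    "uniform_limit {0..T} (\<lambda>x t. f t x) (\<lambda>_. 0) at_top"
    using assms(3) by (auto simp: admissible_data_def)
  have index: "2*j+1 - Suc l = 2*j - l" for l by simp
  have relation: "(\<Sum>l<2*j+1. (\<i> * \<kappa>) ^ (2*j - l) * g_tilde u l t \<zeta>) =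
    (-1)^j * (- exp (- \<i> * \<zeta> * of_real t) * half_fourier (u t) \<kappa> + half_fourier u0 \<kappa> + F j f t \<kappa>)"
    using global_relation[OF assms(2) f pde_on_closure[OF assms(1-4)] Im assms(5,6), folded \<kappa>_def]
    by (simp only: \<zeta> index half_fourier_initial[OF assms(1-4)])
  have "(\<Sum>l<2*j+1. (\<i> * \<kappa>) ^ (2*j - l) * g_tilde u l t \<zeta>) =
    (\<bb> j \<gamma> 0 \<kappa> * g_tilde u 0 t \<zeta> + (\<Sum>l=1..j. \<bb> j \<gamma> l \<kappa> * time_transform (\<phi> l) t \<zeta>)) +
    (\<Sum>m<j. (\<i> * \<kappa>) ^ m * g_tilde u (2*j - m) t \<zeta>)"
    unfolding sum_split_reflect elim by (intro arg_cong2[where f = "(+)"] refl sum.cong) auto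
  then have "\<I> j \<gamma> f u0 \<phi> u p n t k =
      (\<Sum>m<j. (\<i> * \<kappa>) ^ m * g_tilde u (2*j - m) t \<zeta>) + \<bb> j \<gamma> 0 \<kappa> * g_tilde u 0 t \<zeta>"
    unfolding \<I>_def \<kappa>_def[symmetric] \<zeta>_def[symmetric] relation[symmetric] by simp
  moreover have "(\<i> * \<kappa>) ^ m * g_tilde u (2*j - m) t \<zeta> = \<alpha> j p n ^ m * X j u t k (m+1)" if "m < j" for m
    using that by (simp add: X_def \<kappa>_def \<zeta>_def power_mult_distrib)
  ultimately show ?thesis by (simp add: \<kappa>_def \<zeta>_def)
qed

section \<open>The combined relation\<close>

theorem lemma3p2:
  fixes j p :: nat and \<gamma> T t :: real and k :: complex
    and u f :: "real \<Rightarrow> real \<Rightarrow> complex" and u0 :: "real \<Rightarrow> complex"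
    and \<phi> :: "nat \<Rightarrow> real \<Rightarrow> complex"
  assumes "T > 0"
    and "smooth_decaying j T u"
    and "admissible_data j T f u0 \<phi>"
    and "solves_ibvp j \<gamma> T f u0 \<phi> u"
    and "1 \<le> p" and "p \<le> j"
    and "k \<in> D_plus j p" and "k \<noteq> \<i> * of_real \<gamma>"
    and "0 \<le> t" and "t \<le> T"
  shows "(\<Sum>m=0..j-1. X j u t k (m+1)) + \<aa>\<^sub>0 j \<gamma> 1 k * X j u t k (j+1) =
    (\<Sum>n=1..j+1. (L j p n 1
        - poly (Q j p) 1 / poly (pderiv (Q j p)) (\<alpha> j p n) * (k / (k - \<i> * of_real \<gamma>)))
      * \<I> j \<gamma> f u0 \<phi> u p n t k)"
proof -
  let ?c = "\<i> * of_real \<gamma>" and ?g = "g_tilde u 0 t (k ^ (2*j+1))"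
  define w where "w n = L j p n 1 * ((\<alpha> j p n * k - ?c) / (k - ?c))" for n
  have "k \<noteq> 0" using assms(7) by (auto simp: D_plus_def)
  (* Substituting the j + 1 relations leaves, for each unknown, a weighted sum of its coefficients. *)
  have "(\<Sum>n=1..j+1. (L j p n 1
        - poly (Q j p) 1 / poly (pderiv (Q j p)) (\<alpha> j p n) * (k / (k - ?c)))
      * \<I> j \<gamma> f u0 \<phi> u p n t k) =
    (\<Sum>n=1..j+1. w n * ((\<Sum>m<j. \<alpha> j p n ^ m * X j u t k (m+1)) + \<bb> j \<gamma> 0 (\<alpha> j p n * k) * ?g))"
    unfolding w_def
    by (intro sum.cong refl arg_cong2[where f = "(*)"] weight_eq \<I>_eq_unknowns[OF assms(1-4,9,10)]
          Im_\<alpha>_mult_less_0 assms)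
  also have "\<dots> = (\<Sum>m<j. (\<Sum>n=1..j+1. w n * \<alpha> j p n ^ m) * X j u t k (m+1)) +
      (\<Sum>n=1..j+1. w n * \<bb> j \<gamma> 0 (\<alpha> j p n * k)) * ?g"
    unfolding distrib_left sum.distrib sum_distrib_left sum_distrib_right
    by (subst sum.swap) (simp only: mult.assoc)
  also have "(\<Sum>m<j. (\<Sum>n=1..j+1. w n * \<alpha> j p n ^ m) * X j u t k (m+1)) = (\<Sum>m<j. X j u t k (m+1))"
    unfolding w_def
    by (intro sum.cong refl, subst weighted_sum_power)
      (use assms in \<open>auto simp only: lessThan_iff mult_1_left\<close>)
  also have "{..<j} = {0..j-1}" using assms by auto
  also have "(\<Sum>n=1..j+1. w n * \<bb> j \<gamma> 0 (\<alpha> j p n * k)) = \<bb> j \<gamma> 0 k"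
    unfolding w_def using assms by (intro weighted_sum_\<bb>_0)
  also have "\<bb> j \<gamma> 0 k * ?g = \<aa>\<^sub>0 j \<gamma> 1 k * X j u t k (j+1)"
    using \<open>k \<noteq> 0\<close> by (simp add: \<aa>\<^sub>0_def X_def)
  finally show ?thesis by (rule sym)
qed

end
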